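(* Consider the formal planar system $$\dot x=y+xP_1(x),\qquad \dot y=Q_2(x)+yP_1(x),$$ where $P_1,Q_2$ are real formal power series in $x$ with $P_1(0)=0$ and $j^1Q_2(0)=0$, having a monodromic singular point at the origin with Andreev number $n$. If it admits a formal first integral $H(x,y)$, then either $P_1(x)\equiv 0$, or $m=2sn-1$ for some $s\in\mathbb{N}$ (i.e. some integer $s\geqslant 1$), where $m$ is the index of the first nonzero coefficient $a_m$ of $P_1(x)=\sum_{l\geqslant 1}a_lx^l$.
   Context: $j^1Q_2(0)$ is the Taylor polynomial of degree $1$ of $Q_2$ at $0$. For this (formal) system put $f(x)=Q_2(x)-xP_1(x)^2$ and $\Phi(x)=2P_1(x)+xP_1'(x)$. Write $f(x)=ax^\alpha+O(x^{\alpha+1})$ with $a\neq 0$ and $\Phi(x)=bx^\beta+O(x^{\beta+1})$ with $b\neq 0$ (if $\Phi\not\equiv 0$). Monodromic with Andreev number $n$ means: $a<0$, $\alpha=2n-1$, and either $\beta>n-1$ or $\Phi\equiv 0$, or else $\beta=n-1$ and $b^2+4an<0$. A formal first integral is a nonconstant formal power series $H(x,y)$ with $(y+xP_1)\partial_xH+(Q_2+yP_1)\partial_yH=0$. *)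

theory Defs
  imports Complex_Main "HOL-Computational_Algebra.Formal_Power_Series"
begin

text \<open>
  A formal power series in two variables $x$, $y$ is an element of $R[[x]][[y]]$, i.e. a power
  series in $y$ whose coefficients are power series in $x$: the coefficient of $x^i y^j$ in
  \<open>H\<close> is \<open>fps_nth (fps_nth H j) i\<close>.
\<close>

type_synonym 'a fps2 = "'a fps fps"

definition in_x :: "'a::zero fps \<Rightarrow> 'a fps2" where
  "in_x p = fps_const p"

definition var_x :: "'a::{zero,one} fps2" where
  "var_x = in_x fps_X"

definition var_y :: "'a::{zero,one} fps2" where
  "var_y = fps_X"

definition deriv_x :: "'a::comm_semiring_1 fps2 \<Rightarrow> 'a fps2" where
  "deriv_x H = Abs_fps (\<lambda>j. fps_deriv (fps_nth H j))"

definition deriv_y :: "'a::comm_semiring_1 fps2 \<Rightarrow> 'a fps2" where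
  "deriv_y H = fps_deriv H"

definition constant_fps2 :: "'a::zero fps2 \<Rightarrow> bool" where
  "constant_fps2 H \<longleftrightarrow> (\<exists>c. H = fps_const (fps_const c))"

definition formal_first_integral :: "real fps2 \<Rightarrow> real fps2 \<Rightarrow> real fps2 \<Rightarrow> bool" where
  "formal_first_integral X Y H \<longleftrightarrow>
     \<not> constant_fps2 H \<and> X * deriv_x H + Y * deriv_y H = 0"

definition sys_x :: "real fps \<Rightarrow> real fps2" where
  "sys_x P = var_y + var_x * in_x P"

definition sys_y :: "real fps \<Rightarrow> real fps \<Rightarrow> real fps2" where
  "sys_y P Q = in_x Q + var_y * in_x P"

definition andreev_f :: "real fps \<Rightarrow> real fps \<Rightarrow> real fps" where
  "andreev_f P Q = Q - fps_X * P ^ 2"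

definition andreev_Phi :: "real fps \<Rightarrow> real fps" where
  "andreev_Phi P = 2 * P + fps_X * fps_deriv P"

text \<open>
  Here $a$, $b$ are the leading coefficients of $f$, $\Phi$ and $\alpha$, $\beta$ their orders.
  The condition $a < 0$ forces $f \neq 0$. The conditions $\alpha = 2n-1$, $\beta > n-1$ and
  $\beta = n-1$ are written without truncated subtraction; in particular $n \geq 1$.
\<close>

definition monodromic_andreev :: "real fps \<Rightarrow> real fps \<Rightarrow> nat \<Rightarrow> bool" where
  "monodromic_andreev P Q n \<longleftrightarrow>
     (let f = andreev_f P Q; \<alpha> = subdegree f; a = fps_nth f \<alpha>;
          \<Phi> = andreev_Phi P; \<beta> = subdegree \<Phi>; b = fps_nth \<Phi> \<beta>
      in a < 0 \<and> \<alpha> + 1 = 2 * n \<and>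
         (\<Phi> = 0 \<or> \<beta> + 1 > n \<or> (\<beta> + 1 = n \<and> b\<^sup>2 + 4 * a * real n < 0)))"

end

theory Submission
  imports Defs
begin

text \<open>
  Give $x$ weight $1$ and $y$ weight $n$. The lowest weight part of the vector field acts on the
  coefficients $h_j$ of $x^{N-nj}y^j$ in the lowest weight part of $H$ by a three-term recursion,
  and $h_j = 0$ as soon as $nj > N$.
  If $m = n - 1$, all solutions of the recursion with $h_0 \neq 0$ have coefficients of a definite sign
  (up to $y \mapsto -y$), so they never terminate.
  If $m \geq n$, the lowest weight part of $H$ is a multiple of a power of $E_0 = y^2 - a x^{2n}/n$.
  With $z = y + xP_1$, the field $X$ splits as $D + z\Phi\partial_y$, where
  $D$ annihilates $E = z^2 - 2\int f$, whose lowest weight part is $E_0$. Multiples of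
  powers of $E$ are subtracted from $H$ until the remainder $R$ has the weight in which
  the leading term of $z\Phi\partial_y H$ balances $DR$. The resulting
  inhomogeneous recursion has only coefficients of one sign, and it terminates only if
  $2n$ divides $m + 1$.
\<close>

section \<open>Weighted orders\<close>

definition cf :: "real fps2 \<Rightarrow> nat \<Rightarrow> nat \<Rightarrow> real" where
  "cf H i j = fps_nth (fps_nth H j) i"

definition wt_ge :: "nat \<Rightarrow> nat \<Rightarrow> real fps2 \<Rightarrow> bool" where
  "wt_ge n N H \<longleftrightarrow> (\<forall>i j. i + n * j < N \<longrightarrow> cf H i j = 0)"

text \<open>The coefficient of $x^{N-nj}y^j$; the case distinction guards the truncated subtraction.\<close>

definition lead :: "nat \<Rightarrow> nat \<Rightarrow> real fps2 \<Rightarrow> nat \<Rightarrow> real" where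
  "lead n N H j = (if n * j \<le> N then cf H (N - n * j) j else 0)"

lemma cf_diff: "cf (G - H) i j = cf G i j - cf H i j"
  and cf_in_x_mult: "cf (in_x (fps_const c) * H) i j = c * cf H i j"
  by (simp_all add: cf_def in_x_def)

lemma wt_ge_diff: "wt_ge n N G \<Longrightarrow> wt_ge n N H \<Longrightarrow> wt_ge n N (G - H)"
  by (simp add: wt_ge_def cf_diff)

lemma wt_ge_scale: "wt_ge n N H \<Longrightarrow> wt_ge n N (in_x (fps_const c) * H)"
  by (simp add: wt_ge_def cf_in_x_mult)

lemma lead_diff: "lead n N (G - H) j = lead n N G j - lead n N H j"
  and lead_scale: "lead n N (in_x (fps_const c) * H) j = c * lead n N H j"
  by (simp_all add: lead_def cf_diff cf_in_x_mult)

lemma wt_ge_Suc: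
  assumes "wt_ge n N H" and "\<And>j. lead n N H j = 0"
  shows "wt_ge n (Suc N) H"
  unfolding wt_ge_def
proof (intro allI impI)
  fix i j assume ij: "i + n * j < Suc N"
  show "cf H i j = 0"
  proof (cases "i + n * j < N")
    case True
    then show ?thesis using assms(1) by (simp add: wt_ge_def)
  next
    case False
    with ij have "i = N - n * j" "n * j \<le> N" by auto
    then show ?thesis using assms(2)[of j] by (simp add: lead_def)
  qed
qed

lemma wt_ge_mult:
  assumes G: "wt_ge n N G" and H: "wt_ge n M H"
  shows "wt_ge n (N + M) (G * H)"
  unfolding wt_ge_def
proof (intro allI impI)
  fix i j assume ij: "i + n * j < N + M"
  have "fps_nth (fps_nth G b * fps_nth H (j - b)) i = 0" if b: "b \<le> j" for b
    unfolding fps_mult_nth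
  proof (rule sum.neutral, rule ballI)
    fix a assume a: "a \<in> {0..i}"
    have "n * b + n * (j - b) = n * j"
      using b by (simp flip: distrib_left)
    then have "a + n * b < N \<or> (i - a) + n * (j - b) < M"
      using ij a by auto
    then show "fps_nth (fps_nth G b) a * fps_nth (fps_nth H (j - b)) (i - a) = 0"
      using G H by (auto simp: wt_ge_def cf_def)
  qed
  then show "cf (G * H) i j = 0"
    by (simp add: cf_def fps_mult_nth[of G H] fps_sum_nth)
qed

text \<open>The shift \<open>s\<close> will be the weight \<open>n * j\<close> of y^j, so
  \<open>N\<close> bounds a weight rather than an order in x, and \<open>s\<close> may exceed
  \<open>N\<close>.\<close>

lemma fps_mult_nth_eq_0:
  fixes p g :: "real fps"
  assumes p: "\<And>l. l < \<alpha> \<Longrightarrow> fps_nth p l = 0"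
    and g: "\<And>l. l + s < N \<Longrightarrow> fps_nth g l = 0"
    and i: "i + s < N + \<alpha>"
  shows "fps_nth (p * g) i = 0"
  unfolding fps_mult_nth
proof (rule sum.neutral, rule ballI)
  fix l assume "l \<in> {0..i}"
  then have "l < \<alpha> \<or> (i - l) + s < N" using i by auto
  then show "fps_nth p l * fps_nth g (i - l) = 0" using p g by auto
qed

text \<open>If \<open>s > N\<close>, then \<open>i < \<alpha>\<close> and every factor
  \<open>fps_nth p l\<close> of the sum vanishes; this yields the same guard as in
  \<open>lead\<close>.\<close>

lemma fps_mult_nth_lead:
  fixes p g :: "real fps"
  assumes p: "\<And>l. l < \<alpha> \<Longrightarrow> fps_nth p l = 0"
    and g: "\<And>l. l + s < N \<Longrightarrow> fps_nth g l = 0"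
    and i: "i + s = N + \<alpha>"
  shows "fps_nth (p * g) i = (if s \<le> N then fps_nth p \<alpha> * fps_nth g (N - s) else 0)"
proof (cases "s \<le> N")
  case True
  have "fps_nth (p * g) i = (\<Sum>l=0..i. if l = \<alpha> then fps_nth p \<alpha> * fps_nth g (N - s) else 0)"
    unfolding fps_mult_nth
  proof (rule sum.cong, rule refl)
    fix l assume l: "l \<in> {0..i}"
    consider "l < \<alpha>" | "l = \<alpha>" | "l > \<alpha>" by linarith
    then show "fps_nth p l * fps_nth g (i - l)
        = (if l = \<alpha> then fps_nth p \<alpha> * fps_nth g (N - s) else 0)"
    proof cases
      case 2
      have "i - \<alpha> = N - s" using i True by arith
      then show ?thesis using 2 by simp
    next
      case 3
      then have "(i - l) + s < N" using i l by auto
      then show ?thesis using 3 g by simp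
    qed (use p in auto)
  qed
  then show ?thesis using i True by (simp add: sum.delta)
next
  case False
  have "fps_nth (p * g) i = 0"
    unfolding fps_mult_nth
    by (rule sum.neutral) (use False i p in auto)
  then show ?thesis using False by simp
qed

lemma cf_mult_lead_0:
  assumes G: "wt_ge n N G" and H: "wt_ge n M H"
  shows "cf (G * H) (N + M) 0 = cf G N 0 * cf H M 0"
proof -
  have "fps_nth (fps_nth G 0 * fps_nth H 0) (N + M) =
      (if 0 \<le> M then fps_nth (fps_nth G 0) N * fps_nth (fps_nth H 0) (M - 0) else 0)"
    by (rule fps_mult_nth_lead) (use G H in \<open>auto simp: wt_ge_def cf_def\<close>)
  then show ?thesis by (simp add: cf_def)
qed

section \<open>Leading forms of the vector fields\<close>

text \<open>\<open>R\<close> is kept apart from \<open>P\<close> so that one definition serves both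
  the given system (\<open>R = P\<close>) and the field D that annihilates the energy.\<close>

definition vf :: "real fps \<Rightarrow> real fps \<Rightarrow> real fps \<Rightarrow> real fps2 \<Rightarrow> real fps2" where
  "vf P Q R H = (var_y + var_x * in_x P) * deriv_x H + (in_x Q + var_y * in_x R) * deriv_y H"

lemma in_x_simps:
  "in_x (p + q) = in_x p + in_x q" "in_x (p - q) = in_x p - in_x q"
  "in_x (p * q) = in_x p * in_x q" "in_x (- p) = - in_x p" for p q :: "real fps"
  by (simp_all add: in_x_def)

lemma deriv_x_mult: "deriv_x (G * H) = deriv_x G * H + G * deriv_x (H :: real fps2)"
  by (rule fps_ext)
    (simp add: deriv_x_def fps_mult_nth fps_deriv_sum sum.distrib add.commute)

lemma deriv_x_add: "deriv_x (G + H) = deriv_x G + deriv_x (H :: real fps2)"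
  and deriv_x_diff: "deriv_x (G - H) = deriv_x G - deriv_x (H :: real fps2)"
  by (rule fps_ext; simp add: deriv_x_def)+

lemma deriv_x_in_x: "deriv_x (in_x p) = in_x (fps_deriv (p :: real fps))"
  by (rule fps_ext) (simp add: deriv_x_def in_x_def)

lemma deriv_y_in_x: "deriv_y (in_x (p :: real fps)) = 0"
  by (simp add: deriv_y_def in_x_def)

lemma deriv_x_var_y: "deriv_x (var_y :: real fps2) = 0"
  by (rule fps_ext) (simp add: deriv_x_def var_y_def fps_X_nth)

lemma deriv_y_var_y: "deriv_y (var_y :: real fps2) = 1"
  by (simp add: deriv_y_def var_y_def)

lemma vf_add: "vf P Q R (G + H) = vf P Q R G + vf P Q R H"
  by (simp add: vf_def deriv_x_add deriv_y_def algebra_simps)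

lemma vf_diff: "vf P Q R (G - H) = vf P Q R G - vf P Q R H"
  by (simp add: vf_def deriv_x_diff deriv_y_def algebra_simps)

lemma vf_mult: "vf P Q R (G * H) = vf P Q R G * H + G * vf P Q R H"
  by (simp add: vf_def deriv_x_mult deriv_y_def algebra_simps)

lemma vf_in_x: "vf P Q R (in_x g) = (var_y + var_x * in_x P) * in_x (fps_deriv g)"
  by (simp add: vf_def deriv_x_in_x deriv_y_in_x)

lemma vf_scale: "vf P Q R (in_x (fps_const c) * G) = in_x (fps_const c) * vf P Q R G"
  by (simp add: vf_mult vf_in_x) (simp add: in_x_def)

lemma vf_one: "vf P Q R 1 = 0"
  using vf_in_x[of P Q R 1] by (simp add: in_x_def)

lemma vf_power: "vf P Q R E = 0 \<Longrightarrow> vf P Q R (E ^ k) = 0"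
  by (induction k) (simp_all add: vf_mult vf_one)

lemma cf_vf:
  "cf (vf P Q R H) i j =
     (if j = 0 then 0 else (real i + 1) * cf H (i + 1) (j - 1))
     + fps_nth (P * (fps_X * fps_deriv (fps_nth H j))) i
     + (real j + 1) * fps_nth (Q * fps_nth H (j + 1)) i
     + real j * fps_nth (R * fps_nth H j) i"
proof -
  have const: "fps_nth (g * (of_nat k * h)) i = real k * fps_nth (g * h) i" for g h :: "real fps" and k
  proof -
    have "g * (of_nat k * h) = fps_const (real k) * (g * h)"
      by (simp add: mult.left_commute flip: fps_of_nat)
    then show ?thesis by (simp only: fps_mult_left_const_nth)
  qed
  have "fps_nth (vf P Q R H) j =
     (if j = 0 then 0 else fps_deriv (fps_nth H (j - 1)))
     + P * (fps_X * fps_deriv (fps_nth H j))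
     + Q * (of_nat (j + 1) * fps_nth H (j + 1))
     + R * (of_nat j * fps_nth H j)"
    by (cases j)
      (simp_all add: vf_def var_x_def var_y_def in_x_def deriv_x_def deriv_y_def distrib_right
        mult.assoc fps_mult_fps_X_commute mult.left_commute[of fps_X])
  then show ?thesis
    unfolding cf_def by (simp add: const[of _ "Suc j"] const[of _ j] del: of_nat_Suc) (simp add: algebra_simps)
qed

text \<open>Order at least k - 1. With \<open>k = n\<close> for \<open>P\<close>, \<open>R\<close>
  and \<open>k = 2 * n\<close> for \<open>Q\<close>, every term of the field raises the weight by at
  least n - 1, as y d/dx does.\<close>

definition flat :: "nat \<Rightarrow> real fps \<Rightarrow> bool" where
  "flat k p \<longleftrightarrow> (\<forall>l. l + 1 < k \<longrightarrow> fps_nth p l = 0)"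

lemma flatD: "flat k p \<Longrightarrow> l < k - 1 \<Longrightarrow> fps_nth p l = 0"
  by (simp add: flat_def)

lemma X_deriv_nth: "fps_nth (fps_X * fps_deriv g) i = real i * fps_nth g i" for g :: "real fps"
  by (cases i) simp_all

text \<open>The weight N + n - 1 is the lowest that the image can have, so \<open>P\<close>,
  \<open>Q\<close>, \<open>R\<close> enter only through their lowest coefficients. The factors
  \<open>real N - real n * real j\<close> are exponents of x brought down by d/dx.\<close>

lemma cf_vf_lead:
  assumes n: "n > 0" "flat n P" "flat (2 * n) Q" "flat n R" and H: "wt_ge n N H"
    and ij: "i + n * j + 1 = N + n"
  shows "cf (vf P Q R H) i j =
    (if j = 0 then 0 else (real N - real n * (real j - 1)) * lead n N H (j - 1))
    + fps_nth P (n - 1) * (real N - real n * real j) * lead n N H j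
    + fps_nth Q (2 * n - 1) * (real j + 1) * lead n N H (j + 1)
    + fps_nth R (n - 1) * real j * lead n N H j"
proof -
  have H': "l + n * j < N \<Longrightarrow> fps_nth (fps_nth H j) l = 0" for l j
    using H by (simp add: wt_ge_def cf_def)
  have nj: "n * j \<le> N \<Longrightarrow> real (N - n * j) = real N - real n * real j"
    by (simp add: of_nat_diff)
  have "fps_nth (P * (fps_X * fps_deriv (fps_nth H j))) i =
      (if n * j \<le> N then fps_nth P (n - 1) * fps_nth (fps_X * fps_deriv (fps_nth H j)) (N - n * j) else 0)"
    by (rule fps_mult_nth_lead)
      (use n(1) ij H' flatD[OF n(2)] in \<open>auto simp: X_deriv_nth\<close>)
  moreover have "fps_nth (R * fps_nth H j) i =
      (if n * j \<le> N then fps_nth R (n - 1) * fps_nth (fps_nth H j) (N - n * j) else 0)"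
    by (rule fps_mult_nth_lead)
      (use n(1) ij H' flatD[OF n(4)] in auto)
  moreover have "fps_nth (Q * fps_nth H (j + 1)) i =
      (if n * (j + 1) \<le> N then fps_nth Q (2 * n - 1) * fps_nth (fps_nth H (j + 1)) (N - n * (j + 1)) else 0)"
    by (rule fps_mult_nth_lead)
      (use n(1) ij H'[of _ "j + 1"] flatD[OF n(3)] in auto)
  moreover have "(real i + 1) * cf H (i + 1) (j - 1)
      = (real N - real n * (real j - 1)) * lead n N H (j - 1)" if "j > 0"
  proof -
    obtain j' where j': "j = Suc j'" using \<open>j > 0\<close> by (cases j) auto
    then have "i + 1 + n * j' = N" using ij by simp
    then have "i + 1 = N - n * j'" "n * j' \<le> N" "real i + 1 = real N - real n * real j'"
      by (auto simp flip: of_nat_mult)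
    then show ?thesis using j' by (simp add: lead_def)
  qed
  ultimately show ?thesis
    unfolding cf_vf X_deriv_nth by (simp add: nj lead_def cf_def)
qed

text \<open>Extends the recursion to every \<open>j\<close>, including those for which no x^i y^j
  has weight N + n - 1. There \<open>n * (j - 1) \<ge> N\<close>, so the entries at \<open>j\<close>
  and \<open>j + 1\<close> vanish, and at \<open>j - 1\<close> either the entry or its factor
  does.\<close>

lemma lead_recursion:
  assumes n: "n > 0" "flat n P" "flat (2 * n) Q" "flat n R" and H: "wt_ge n N H"
    and g: "\<And>i j. i + n * j + 1 = N + n \<Longrightarrow> cf (vf P Q R H) i j = g j"
    and g0: "\<And>j. N + n < n * j + 1 \<Longrightarrow> g j = 0"
  shows "(if j = 0 then 0 else (real N - real n * (real j - 1)) * lead n N H (j - 1))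
    + fps_nth P (n - 1) * (real N - real n * real j) * lead n N H j
    + fps_nth Q (2 * n - 1) * (real j + 1) * lead n N H (j + 1)
    + fps_nth R (n - 1) * real j * lead n N H j = g j"
proof (cases "n * j + 1 \<le> N + n")
  case True
  then have "N + n - (n * j + 1) + n * j + 1 = N + n" by simp
  from g[OF this] cf_vf_lead[OF n H this] show ?thesis by simp
next
  case False
  then obtain j' where j': "j = Suc j'" using n(1) by (cases j) auto
  have "n * j' \<ge> N" using False j' by simp
  then have "n * j' = N \<or> n * j' > N" by linarith
  then have "(real N - real n * real j') * lead n N H j' = 0"
    by (auto simp: lead_def)
  moreover have "lead n N H j = 0" "lead n N H (j + 1) = 0"
    using False n(1) by (auto simp: lead_def)
  ultimately show ?thesis using j' g0[of j] False by simp
qed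

section \<open>The three-term recursions\<close>

text \<open>As \<open>q\<close> is nonzero, each \<open>h (j + 1)\<close> is determined by the two
  preceding entries. Thus a nonzero lowest weight part must contain a pure power of x.\<close>

lemma recursion_zero:
  fixes h :: "nat \<Rightarrow> real"
  assumes q: "q \<noteq> 0"
    and rec: "\<And>j. (if j = 0 then 0 else c j * h (j - 1)) + d j * h j + q * (real j + 1) * h (j + 1) + e j * h j = 0"
    and "h 0 = 0"
  shows "h j = 0"
proof (induction j rule: less_induct)
  case (less j)
  show ?case
  proof (cases j)
    case 0
    then show ?thesis using assms by simp
  next
    case (Suc l)
    have "q * (real l + 1) * h (l + 1) = 0"
      using rec[of l] less.IH[of l] less.IH[of "l - 1"] Suc by (auto split: if_splits)
    then show ?thesis using q Suc by simp
  qed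
qed

text \<open>
  All \<open>h 0 * p ^ j * h j\<close> are positive; the factor \<open>p ^ j\<close> absorbs the sign of \<open>p\<close>.
\<close>

lemma recursion_focus:
  fixes h :: "nat \<Rightarrow> real"
  assumes n: "n > 0" and N: "N > 0" and q: "q < 0" and p: "p \<noteq> 0"
    and fin: "\<And>j. N < n * j \<Longrightarrow> h j = 0"
    and rec: "\<And>j. (if j = 0 then 0 else (real N - real n * (real j - 1)) * h (j - 1))
      + p * (real N - real n * real j) * h j + q * (real j + 1) * h (j + 1) + p * real j * h j = 0"
  shows "h 0 = 0"
proof (rule ccontr)
  assume h0: "h 0 \<noteq> 0"
  define g where "g j = h 0 * p ^ j * h j" for j
  have g0: "g 0 > 0" using h0 by (simp add: g_def) (metis not_real_square_gt_zero)
  have pp: "p * p > 0" using p by (metis not_real_square_gt_zero)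
  have "n * j \<le> N \<Longrightarrow> g j > 0 \<and> g (j + 1) > 0" for j
  proof (induction j)
    case 0
    have "(- q) * g 1 = (p * p) * real N * g 0"
      using arg_cong[OF rec[of 0], of "\<lambda>t. h 0 * p * t"] by (simp add: g_def algebra_simps)
    then have "(- q) * g 1 > 0" using pp N g0 by simp
    then show ?case using q g0 by (simp add: mult_less_0_iff)
  next
    case (Suc j)
    then have IH: "g j > 0" "g (j + 1) > 0" by auto
    have le: "real n * (real j + 1) \<le> real N"
      using of_nat_mono[OF Suc.prems, where 'a = real] by (simp add: algebra_simps)
    have e: "(- q) * (real j + 2) * g (j + 2) =
        (p * p) * ((real N - real n * real j) * g j)
        + (p * p) * ((real N - real n * (real j + 1) + (real j + 1)) * g (j + 1))"
      using arg_cong[OF rec[of "j + 1"], of "\<lambda>t. h 0 * p ^ (j + 2) * t"]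
      by (simp add: g_def algebra_simps)
    have A: "(real N - real n * real j) * g j \<ge> 0"
      using le IH by (intro mult_nonneg_nonneg) (auto simp: algebra_simps)
    \<comment> \<open>The summand \<open>real j + 1\<close> comes from y P d/dy and keeps the factor
      positive even if N = n(j + 1).\<close>
    have B: "(real N - real n * (real j + 1) + (real j + 1)) * g (j + 1) > 0"
      using le IH by (intro mult_pos_pos) auto
    have "(- q) * (real j + 2) * g (j + 2) > 0"
      unfolding e by (intro add_nonneg_pos mult_nonneg_nonneg[OF less_imp_le[OF pp] A] mult_pos_pos[OF pp B])
    moreover have "(- q) * (real j + 2) > 0" using q by (intro mult_pos_pos) auto
    ultimately have "g (j + 2) > 0" using zero_less_mult_pos by blast
    then show ?case using IH by simp
  qed
  \<comment> \<open>The last index that the induction covers; the next entry is nonzero although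
    \<open>fin\<close> makes it vanish.\<close>
  from this[of "N div n"] have "g (N div n + 1) > 0" by simp
  moreover have "N < n * (N div n + 1)"
    using dividend_less_times_div[OF n, of N] by simp
  ultimately show False using fin[of "N div n + 1"] by (simp add: g_def)
qed

text \<open>On even indices, \<open>h (2 * l + 2)\<close> is a positive multiple of (N - 2nl)
  \<open>h (2 * l)\<close>. The sign of \<open>h 0\<close> therefore persists until that factor
  vanishes, and the sequence can terminate only if the factor does vanish for some l.\<close>

lemma recursion_center:
  fixes h :: "nat \<Rightarrow> real"
  assumes n: "n > 0" and q: "q < 0"
    and fin: "\<And>j. N < n * j \<Longrightarrow> h j = 0"
    and rec: "\<And>j. (if j = 0 then 0 else (real N - real n * (real j - 1)) * h (j - 1))
      + q * (real j + 1) * h (j + 1) = 0"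
    and h0: "h 0 \<noteq> 0"
  shows "2 * n dvd N" and "h 0 * h (2 * l) \<ge> 0" and "N > 0 \<Longrightarrow> h 0 * h 2 > 0"
proof -
  have step: "(- q) * (2 * real l + 2) * (h 0 * h (2 * l + 2)) =
      (real N - 2 * real n * real l) * (h 0 * h (2 * l))" for l
    using arg_cong[OF rec[of "2 * l + 1"], of "\<lambda>t. h 0 * t"] by (simp add: algebra_simps)
  have c: "(- q) * (2 * real l + 2) > 0" for l using q by (intro mult_pos_pos) auto
  have "h 0 * h 0 > 0" using h0 by (metis not_real_square_gt_zero)
  have pos: "2 * n * l < N \<Longrightarrow> h 0 * h (2 * l) > 0 \<and> h 0 * h (2 * l + 2) > 0" for l
  proof (induction l)
    case 0
    then have "(- q) * (2 * real 0 + 2) * (h 0 * h (2 * 0 + 2)) > 0"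
      unfolding step using \<open>h 0 * h 0 > 0\<close> by simp
    from zero_less_mult_pos[OF this c] show ?case using \<open>h 0 * h 0 > 0\<close> by simp
  next
    case (Suc l)
    then have IH: "h 0 * h (2 * Suc l) > 0" by simp
    have "2 * real n * real (Suc l) < real N"
      using Suc.prems by (simp flip: of_nat_Suc of_nat_mult of_nat_numeral[where 'a = real] del: of_nat_numeral)
    then have "(- q) * (2 * real (Suc l) + 2) * (h 0 * h (2 * Suc l + 2)) > 0"
      unfolding step by (intro mult_pos_pos[OF _ IH]) simp
    from zero_less_mult_pos[OF this c] show ?case using IH by simp
  qed
  show "2 * n dvd N"
  proof (rule ccontr)
    assume nd: "\<not> 2 * n dvd N"
    let ?l = "N div (2 * n)"
    have "2 * n * ?l < N"
      using nd times_div_less_eq_dividend[of "2 * n" N] dvd_triv_left[of "2 * n" ?l]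
      by (metis le_neq_implies_less)
    then have "h (2 * ?l + 2) \<noteq> 0" using pos[of ?l] by auto
    moreover have "N < 2 * n * (?l + 1)"
      using n dividend_less_times_div[of "2 * n" N] by simp
    then have "N < n * (2 * ?l + 2)" by (simp add: algebra_simps)
    ultimately show False using fin by blast
  qed
  then obtain k where k: "N = 2 * n * k" by blast
  show "h 0 * h (2 * l) \<ge> 0"
  proof (cases "l \<le> k")
    case True
    show ?thesis
    proof (cases l)
      case 0
      then show ?thesis using \<open>h 0 * h 0 > 0\<close> by simp
    next
      case (Suc l')
      then have "2 * n * l' < N" using True k n by simp
      then show ?thesis using pos[of l'] Suc by simp
    qed
  next
    case False
    then have "N < n * (2 * l)" using k n by simp
    then show ?thesis using fin by simp
  qed
  show "N > 0 \<Longrightarrow> h 0 * h 2 > 0" using pos[of 0] by (simp add: numeral_2_eq_2)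
qed

text \<open>On odd indices the chain starts at zero and is driven by the forcing from
  \<open>h\<close>, all of one sign. The factor M - n(2l + 1) stays positive up to the degree bound
  and skips zero unless 2n divides m + 1, so otherwise an entry beyond the bound is nonzero.\<close>

lemma recursion_obstruction:
  fixes h r :: "nat \<Rightarrow> real"
  assumes n: "n > 0" and q: "q < 0" and c: "c \<noteq> 0" and k: "k > 0"
    and M: "M + n = m + 1 + 2 * n * k"
    and fin: "\<And>j. M < n * j \<Longrightarrow> r j = 0"
    and rec: "\<And>j. (if j = 0 then 0 else (real M - real n * (real j - 1)) * r (j - 1))
      + q * (real j + 1) * r (j + 1) = - (c * real j * h j)"
    and h_nonneg: "\<And>l. h 0 * h (2 * l) \<ge> 0" and h2: "h 0 * h 2 > 0"
  shows "2 * n dvd m + 1"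
proof (rule ccontr)
  assume nd: "\<not> 2 * n dvd m + 1"
  \<comment> \<open>Multiplying by \<open>c * h 0\<close> turns the forcing into
    \<open>c * c\<close> times the nonnegative products \<open>h 0 * h (2 * l)\<close>.\<close>
  define s where "s j = c * h 0 * r j" for j
  have step: "(- q) * (2 * real l + 3) * s (2 * l + 3) =
      (real M - real n * (2 * real l + 1)) * s (2 * l + 1)
      + (c * c) * (2 * real l + 2) * (h 0 * h (2 * l + 2))" for l
    using arg_cong[OF rec[of "2 * l + 2"], of "\<lambda>t. c * h 0 * t"]
    by (simp add: s_def algebra_simps numeral_3_eq_3)
  have cc: "c * c > 0" using c by (metis not_real_square_gt_zero)
  have q3: "(- q) * (2 * real l + 3) > 0" for l using q by (intro mult_pos_pos) auto
  have s1: "s 1 = 0" using rec[of 0] q by (simp add: s_def)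
  have pos: "2 * n * (l + 1) < m + 1 + 2 * n * k \<Longrightarrow> s (2 * l + 3) > 0" for l
  proof (induction l)
    case 0
    have "(- q) * (2 * real 0 + 3) * s (2 * 0 + 3) > 0"
      unfolding step using s1 cc h2 by (simp add: numeral_2_eq_2)
    from zero_less_mult_pos[OF this q3] show ?case by simp
  next
    case (Suc l)
    then have IH: "s (2 * l + 3) > 0" by simp
    have "n * (2 * Suc l + 1) < M" using Suc.prems M by (simp add: algebra_simps)
    then have "real n * (2 * real (Suc l) + 1) < real M"
      using of_nat_less_iff[of "n * (2 * Suc l + 1)" M, where 'a = real]
      by (simp add: algebra_simps)
    then have "(real M - real n * (2 * real (Suc l) + 1)) * s (2 * Suc l + 1) > 0"
      using IH by (intro mult_pos_pos) (auto simp: numeral_3_eq_3)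
    moreover have hh: "h 0 * h (2 * Suc l + 2) \<ge> 0"
      using h_nonneg[of "l + 2"] by simp
    have "(c * c) * (2 * real (Suc l) + 2) * (h 0 * h (2 * Suc l + 2)) \<ge> 0"
      by (intro mult_nonneg_nonneg[OF _ hh]) simp
    ultimately have "(- q) * (2 * real (Suc l) + 3) * s (2 * Suc l + 3) > 0"
      unfolding step by linarith
    from zero_less_mult_pos[OF this q3] show ?case by simp
  qed
  \<comment> \<open>Since \<open>M = ?T - n\<close>, the index 2 \<open>?L\<close> + 1 is the first
    odd one beyond the bound; \<open>k > 0\<close> gives \<open>?L \<ge> 1\<close>, so the
    positivity claim reaches it.\<close>
  let ?T = "m + 1 + 2 * n * k"
  let ?L = "?T div (2 * n)"
  have ndT: "\<not> 2 * n dvd ?T" using nd dvd_add_left_iff[of "2 * n" "2 * n * k" "m + 1"] by simp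
  have L: "?L = (m + 1) div (2 * n) + k"
    using n div_mult_self2[of "2 * n" "m + 1" k] by simp
  then obtain l where l: "?L = l + 1" using k by (cases "?L") auto
  have "2 * n * ?L < ?T"
    using ndT times_div_less_eq_dividend[of "2 * n" ?T] dvd_triv_left[of "2 * n" ?L]
    by (metis le_neq_implies_less)
  then have "s (2 * l + 3) > 0" using pos[of l] l by simp
  moreover have "?T < 2 * n * (?L + 1)"
    using n dividend_less_times_div[of "2 * n" ?T] by simp
  then have "M < n * (2 * l + 3)" using M l by (simp add: algebra_simps)
  ultimately show False using fin by (simp add: s_def)
qed

section \<open>The Hamiltonian part\<close>

definition energy :: "real fps \<Rightarrow> real fps \<Rightarrow> real fps2" where
  "energy P Q = (var_y + var_x * in_x P) ^ 2 - 2 * in_x (fps_integral0 (andreev_f P Q))"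

text \<open>With z = y + xP this field gives x' = z and y' = Q + yP - z\<Phi>, and \<Phi> is just
  what makes z' = f. Hence z^2 and twice the integral of f have the same derivative 2zf.\<close>

lemma vf_energy:
  "vf P (Q - fps_X * P * andreev_Phi P) (P - andreev_Phi P) (energy P Q) = 0"
proof -
  let ?D = "vf P (Q - fps_X * P * andreev_Phi P) (P - andreev_Phi P)"
  let ?Z = "var_y + var_x * in_x P :: real fps2"
  have X: "var_x * in_x P = in_x (fps_X * P)" by (simp add: var_x_def in_x_simps)
  have two: "in_x (2 :: real fps) = 2" by (simp add: in_x_def numeral_fps_const)
  have "?D ?Z = ?D var_y + ?D (in_x (fps_X * P))" by (simp add: X vf_add)
  also have "?D var_y = in_x (Q - fps_X * P * andreev_Phi P) + var_y * in_x (P - andreev_Phi P)"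
    by (simp add: vf_def deriv_x_var_y deriv_y_var_y)
  also have "?D (in_x (fps_X * P)) = ?Z * in_x (P + fps_X * fps_deriv P)"
    by (simp add: vf_in_x add.commute)
  also have "in_x (Q - fps_X * P * andreev_Phi P) + var_y * in_x (P - andreev_Phi P)
      + ?Z * in_x (P + fps_X * fps_deriv P) = in_x (andreev_f P Q)"
    by (simp add: andreev_f_def andreev_Phi_def in_x_simps two var_x_def power2_eq_square algebra_simps)
  finally have Z: "?D ?Z = in_x (andreev_f P Q)" .
  have two': "(2 :: real fps2) = in_x (fps_const 2)" by (simp add: in_x_def numeral_fps_const)
  have "?D (2 * in_x (fps_integral0 (andreev_f P Q))) = 2 * (?Z * in_x (andreev_f P Q))"
    unfolding two' vf_scale by (simp add: vf_in_x fps_deriv_fps_integral)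
  then show ?thesis
    by (simp add: energy_def vf_diff power2_eq_square vf_mult Z two)
qed

text \<open>As xP has order above n, the lowest part of z is y alone. So x^(2n) arises only from the
  integral, with coefficient -a/n.\<close>

lemma energy_wt:
  assumes n: "n > 0" and P: "\<And>l. l < n \<Longrightarrow> fps_nth P l = 0"
    and f: "flat (2 * n) (andreev_f P Q)" and a: "fps_nth (andreev_f P Q) (2 * n - 1) \<noteq> 0"
  shows "wt_ge n (2 * n) (energy P Q)" and "cf (energy P Q) (2 * n) 0 \<noteq> 0"
proof -
  let ?Z = "var_y + var_x * in_x P :: real fps2"
  have Zcf: "cf ?Z i j = (if j = 1 \<and> i = 0 then 1 else 0) +
      (if j = 0 \<and> i > 0 then fps_nth P (i - 1) else 0)" for i j
    by (auto simp: cf_def var_y_def var_x_def in_x_def fps_X_nth)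
  have two: "(2 :: real fps2) = in_x (fps_const 2)" by (simp add: in_x_def numeral_fps_const)
  have Z: "wt_ge n n ?Z" using P by (auto simp: wt_ge_def Zcf)
  have Icf: "cf (in_x (fps_integral0 (andreev_f P Q))) i j =
      (if j = 0 \<and> i > 0 then fps_nth (andreev_f P Q) (i - 1) / real i else 0)" for i j
    by (auto simp: cf_def in_x_def fps_integral_def inverse_eq_divide field_simps)
  have I: "wt_ge n (2 * n) (in_x (fps_integral0 (andreev_f P Q)))"
    using f by (auto simp: wt_ge_def Icf flat_def)
  have ZZ: "wt_ge n (2 * n) (?Z ^ 2)"
    using wt_ge_mult[OF Z Z] by (simp add: power2_eq_square mult_2)
  then show "wt_ge n (2 * n) (energy P Q)"
    unfolding energy_def two by (intro wt_ge_diff wt_ge_scale I)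
  have "cf (?Z ^ 2) (2 * n) 0 = 0"
    using cf_mult_lead_0[OF Z Z] P n by (simp add: power2_eq_square Zcf mult_2)
  then show "cf (energy P Q) (2 * n) 0 \<noteq> 0"
    unfolding energy_def two cf_diff cf_in_x_mult using n a by (simp add: Icf)
qed

text \<open>The surviving pure x-term is what later allows a multiple of \<open>E ^ k\<close> to
  cancel the pure x-term of a remainder.\<close>

lemma wt_ge_power:
  assumes "wt_ge n N E" and "cf E N 0 \<noteq> 0"
  shows "wt_ge n (N * k) (E ^ k) \<and> cf (E ^ k) (N * k) 0 \<noteq> 0"
proof (induction k)
  case 0
  then show ?case by (simp add: wt_ge_def cf_def)
next
  case (Suc k)
  then show ?case
    using wt_ge_mult[OF assms(1), of "N * k" "E ^ k"] cf_mult_lead_0[OF assms(1), of "N * k" "E ^ k"] assms(2)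
    by simp
qed

section \<open>The first integral\<close>

text \<open>The factor i + 2 never vanishes, so \<Phi> and P have the same order.\<close>

lemma andreev_Phi_nth: "fps_nth (andreev_Phi P) i = (real i + 2) * fps_nth P i"
  unfolding andreev_Phi_def fps_add_nth X_deriv_nth numeral_fps_const fps_mult_left_const_nth
  by (simp add: distrib_right)

theorem theorem36:
  fixes P\<^sub>1 Q\<^sub>2 :: "real fps" and n :: nat
  assumes "fps_nth P\<^sub>1 0 = 0"
    and "fps_nth Q\<^sub>2 0 = 0" and "fps_nth Q\<^sub>2 1 = 0"
    and "monodromic_andreev P\<^sub>1 Q\<^sub>2 n"
    and "\<exists>H. formal_first_integral (sys_x P\<^sub>1) (sys_y P\<^sub>1 Q\<^sub>2) H"
  shows "P\<^sub>1 = 0 \<or> (\<exists>s::nat. s \<ge> 1 \<and> subdegree P\<^sub>1 = 2 * s * n - 1)"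
proof (cases "P\<^sub>1 = 0")
  case False

  \<comment> \<open>Orders and leading coefficients of P, \<Phi>, f and Q\<close>
  define P Q where "P = P\<^sub>1" and "Q = Q\<^sub>2"
  with False have "P \<noteq> 0" by (simp add: P_def)
  define m f \<Phi> where "m = subdegree P" and "f = andreev_f P Q" and "\<Phi> = andreev_Phi P"
  define a p where "a = fps_nth f (2 * n - 1)" and "p = fps_nth P (n - 1)"
  have Pm: "fps_nth P m \<noteq> 0" using \<open>P \<noteq> 0\<close> by (simp add: m_def)
  have Pl: "l < m \<Longrightarrow> fps_nth P l = 0" for l unfolding m_def by (rule nth_less_subdegree_zero)
  have \<Phi>l: "l < m \<Longrightarrow> fps_nth \<Phi> l = 0" for l by (simp add: \<Phi>_def andreev_Phi_nth Pl)
  have \<Phi>m: "fps_nth \<Phi> m \<noteq> 0" using Pm by (simp add: \<Phi>_def andreev_Phi_nth)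
  then have sub\<Phi>: "subdegree \<Phi> = m" and \<Phi>0: "\<Phi> \<noteq> 0" using \<Phi>l by (auto intro: subdegreeI)
  have mon: "a < 0" "subdegree f + 1 = 2 * n"
    "m + 1 > n \<or> (m + 1 = n \<and> (fps_nth \<Phi> m)\<^sup>2 + 4 * a * real n < 0)"
  proof -
    have 2: "fps_nth f (subdegree f) < 0 \<and> subdegree f + 1 = 2 * n \<and>
      (m + 1 > n \<or> (m + 1 = n \<and> (fps_nth \<Phi> m)\<^sup>2 + 4 * fps_nth f (subdegree f) * real n < 0))"
      using assms(4) \<Phi>0 unfolding monodromic_andreev_def Let_def
      by (fold P_def Q_def, fold f_def \<Phi>_def, unfold sub\<Phi>) simp
    then have "subdegree f = 2 * n - 1" by linarith
    with 2 show "a < 0" "subdegree f + 1 = 2 * n"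
      "m + 1 > n \<or> (m + 1 = n \<and> (fps_nth \<Phi> m)\<^sup>2 + 4 * a * real n < 0)"
      by (simp_all add: a_def)
  qed
  have n: "n > 0" and nm: "n \<le> m + 1" using mon by auto
  have flatP: "flat n P" using nm by (simp add: flat_def Pl)
  have flatf: "flat (2 * n) f" 
    unfolding flat_def using mon(2) by (intro allI impI nth_less_subdegree_zero) linarith
  have PP: "l < 2 * m \<Longrightarrow> fps_nth (P * P) l = 0" for l
    by (rule fps_mult_nth_eq_0[of m P 0 m P]) (simp_all add: Pl)
  have P\<Phi>: "l < 2 * m \<Longrightarrow> fps_nth (P * \<Phi>) l = 0" for l
    by (rule fps_mult_nth_eq_0[of m P 0 m \<Phi>]) (simp_all add: Pl \<Phi>l)
  have Q: "Q = f + fps_X * (P * P)" by (simp add: f_def andreev_f_def power2_eq_square)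
  have flatQ: "flat (2 * n) Q"
    using flatf nm by (auto simp: flat_def Q PP)
  have Qlead: "fps_nth Q (2 * n - 1) = a + p\<^sup>2"
  proof -
    have "fps_nth (P * P) (2 * n - 2) =
        (if 0 \<le> n - 1 then fps_nth P (n - 1) * fps_nth P (n - 1 - 0) else 0)"
      by (rule fps_mult_nth_lead) (use n nm in \<open>auto simp: Pl\<close>)
    then show ?thesis using n by (simp add: Q a_def p_def power2_eq_square numeral_2_eq_2)
  qed
  define q where "q = a + p\<^sup>2"
  have q: "q < 0"
  proof (cases "m + 1 = n")
    case False
    then have "n - 1 < m" using n nm by linarith
    then have "p = 0" unfolding p_def by (rule Pl)
    then show ?thesis using mon by (simp add: q_def)
  next
    case True
    then have "fps_nth \<Phi> m = (real n + 1) * p"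
      by (auto simp: \<Phi>_def andreev_Phi_nth p_def)
    then have "(real n + 1)\<^sup>2 * p\<^sup>2 + 4 * a * real n < 0"
      using mon(3) True by (simp add: power_mult_distrib)
    \<comment> \<open>By (n - 1)^2 >= 0; it turns the discriminant condition with b = (n + 1)p into
      a + p^2 < 0.\<close>
    moreover have "4 * real n * p\<^sup>2 \<le> (real n + 1)\<^sup>2 * p\<^sup>2"
      using zero_le_power2[of "real n - 1"]
      by (intro mult_right_mono) (auto simp: power2_eq_square algebra_simps)
    ultimately have "4 * real n * q < 0" by (simp add: q_def algebra_simps)
    then show ?thesis using n by (simp add: mult_less_0_iff)
  qed

  \<comment> \<open>The lowest weight part of the first integral, and the bound n <= m\<close>
  obtain H where H: "\<not> constant_fps2 H" "vf P Q P H = 0"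
    using assms(5) by (auto simp: formal_first_integral_def vf_def sys_x_def sys_y_def P_def Q_def)
  \<comment> \<open>Removing the constant term makes the lowest weight \<open>N\<close>
    positive.\<close>
  define H1 where "H1 = H - in_x (fps_const (cf H 0 0))"
  have vfH1: "vf P Q P H1 = 0"
    using H(2) by (simp add: H1_def vf_diff vf_in_x) (simp add: in_x_def)
  have "H1 \<noteq> 0" using H(1) by (auto simp: H1_def constant_fps2_def in_x_def)
  then obtain i j where ij: "cf H1 i j \<noteq> 0"
    by (metis cf_def fps_ext fps_zero_nth)
  define N where "N = (LEAST w. \<exists>i j. i + n * j = w \<and> cf H1 i j \<noteq> 0)"
  have "\<exists>i j. i + n * j = N \<and> cf H1 i j \<noteq> 0"
    unfolding N_def by (rule LeastI_ex) (use ij in blast)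
  then obtain i j where ij: "i + n * j = N" "cf H1 i j \<noteq> 0" by blast
  have wtH1: "wt_ge n N H1"
    unfolding wt_ge_def N_def using not_less_Least by blast
  have "lead n N H1 j \<noteq> 0" using ij by (auto simp: lead_def)
  have "cf H1 0 0 = 0" by (simp add: H1_def cf_def in_x_def)
  with ij n have N: "N > 0" by (cases "i = 0 \<and> j = 0") auto
  define h where "h = lead n N H1"
  have hfin: "N < n * j \<Longrightarrow> h j = 0" for j by (simp add: h_def lead_def)
  have hrec: "(if j = 0 then 0 else (real N - real n * (real j - 1)) * h (j - 1))
      + p * (real N - real n * real j) * h j + q * (real j + 1) * h (j + 1) + p * real j * h j = 0" for j
    unfolding h_def p_def q_def[folded Qlead]
    by (rule lead_recursion[OF n flatP flatQ flatP wtH1, where g = "\<lambda>_. 0"]) (simp_all add: vfH1 cf_def)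
  have h0: "h 0 \<noteq> 0"
    using recursion_zero[of q "\<lambda>j. real N - real n * (real j - 1)" h
        "\<lambda>j. p * (real N - real n * real j)" "\<lambda>j. p * real j" j] hrec q \<open>lead n N H1 j \<noteq> 0\<close>
    by (auto simp: h_def)
  \<comment> \<open>A nonzero \<open>p\<close> would force \<open>h 0 = 0\<close>; since
    \<open>p\<close> is the coefficient of index n - 1, this excludes m = n - 1.\<close>
  have p0: "p = 0" using recursion_focus[OF n N q _ hfin hrec] h0 by blast
  have mn: "n \<le> m"
  proof (rule ccontr)
    assume "\<not> n \<le> m"
    then have "m = n - 1" using nm by simp
    then show False using Pm p0 by (simp add: p_def)
  qed
  have hrec': "(if j = 0 then 0 else (real N - real n * (real j - 1)) * h (j - 1))
      + q * (real j + 1) * h (j + 1) = 0" for j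
    using hrec[of j] p0 by simp
  have center: "2 * n dvd N" "h 0 * h (2 * l) \<ge> 0" "h 0 * h 2 > 0" for l
    by (rule recursion_center[OF n q _ hrec' h0]; simp add: hfin N)+
  obtain k where k: "N = 2 * n * k" using center(1) by blast
  then have k0: "k > 0" using N by (cases k) auto

  \<comment> \<open>The Hamiltonian part D and its defect on the first integral\<close>
  define Q' R' where "Q' = Q - fps_X * P * \<Phi>" and "R' = P - \<Phi>"
  define D where "D = vf P Q' R'"
  have flatR': "flat n R'" using mn by (simp add: flat_def R'_def Pl \<Phi>l)
  have R'lead: "fps_nth R' (n - 1) = 0" using mn n by (simp add: R'_def Pl \<Phi>l)
  have XP\<Phi>: "fps_nth (fps_X * P * \<Phi>) l = 0" if "l < 2 * m + 1" for l
    using that P\<Phi>[of "l - 1"] by (cases l) (simp_all add: mult.assoc)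
  have flatQ': "flat (2 * n) Q'" using flatQ mn by (simp add: flat_def Q'_def XP\<Phi>)
  have Q'lead: "fps_nth Q' (2 * n - 1) = q" using mn n by (simp add: Q'_def XP\<Phi> Qlead q_def del: One_nat_def)
  \<comment> \<open>The full field kills \<open>H1\<close>, so D \<open>H1\<close> equals -z\<Phi>
    d/dy \<open>H1\<close>; the two terms come from z = xP + y.\<close>
  have T: "cf (D H1) i j = - ((real j + 1) * fps_nth (fps_X * P * \<Phi> * fps_nth H1 (j + 1)) i
      + real j * fps_nth (\<Phi> * fps_nth H1 j) i)" for i j
  proof -
    have "cf (vf P Q P H1) i j = 0" by (simp add: vfH1 cf_def)
    then show ?thesis
      unfolding D_def cf_vf Q'_def R'_def by (simp add: left_diff_distrib right_diff_distrib)
  qed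
  have H1_nth: "l + n * j < N \<Longrightarrow> fps_nth (fps_nth H1 j) l = 0" for l j
    using wtH1 by (simp add: wt_ge_def cf_def)
  \<comment> \<open>The term with xP\<Phi> d/dy raises the weight by at least 2m + 1 - n, which
    exceeds m because n <= m.\<close>
  have T1: "fps_nth (fps_X * P * \<Phi> * fps_nth H1 (j + 1)) i = 0" if "i + n * j \<le> N + m" for i j
    by (rule fps_mult_nth_eq_0[of "2 * m + 1" _ "n * (j + 1)" N, OF XP\<Phi> H1_nth]) (use that mn in auto)
  have Tlow: "cf (D H1) i j = 0" if "i + n * j < N + m" for i j
  proof -
    have "fps_nth (\<Phi> * fps_nth H1 j) i = 0"
      by (rule fps_mult_nth_eq_0[of m _ "n * j" N, OF \<Phi>l H1_nth]) (use that in auto)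
    then show ?thesis using T T1 that by simp
  qed
  have Tlead: "cf (D H1) i j = - (fps_nth \<Phi> m * real j * h j)" if "i + n * j = N + m" for i j
  proof -
    have "fps_nth (\<Phi> * fps_nth H1 j) i =
        (if n * j \<le> N then fps_nth \<Phi> m * fps_nth (fps_nth H1 j) (N - n * j) else 0)"
      by (rule fps_mult_nth_lead[of m _ "n * j" N, OF \<Phi>l H1_nth]) (use that in auto)
    then show ?thesis using T T1 that by (simp add: h_def lead_def cf_def)
  qed

  \<comment> \<open>Subtracting multiples of powers of the energy\<close>
  define E where "E = energy P Q"
  have DE: "D E = 0" unfolding D_def Q'_def R'_def \<Phi>_def E_def by (rule vf_energy)
  have E: "wt_ge n (2 * n) E" "cf E (2 * n) 0 \<noteq> 0"
    unfolding E_def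
    by (rule energy_wt[OF n]; use mn flatf mon(1) in \<open>simp add: Pl f_def a_def del: One_nat_def\<close>)+

  \<comment> \<open>The bound on \<open>M\<close> is where forcing sets in: D sends weight M to
    weight at least M + n - 1, while D \<open>H1\<close> starts at weight N + m. In the step from
    \<open>M\<close> to \<open>Suc M\<close> the recursion is thus still homogeneous.\<close>
  have approx: "M + n \<le> N + m + 1 \<Longrightarrow> \<exists>G. D G = 0 \<and> wt_ge n M (H1 - G)" for M
  proof (induction M)
    case 0
    have "D 0 = 0 \<and> wt_ge n 0 (H1 - 0)" using vf_diff[of P Q' R' 0 0] by (simp add: D_def wt_ge_def)
    then show ?case by blast
  next
    case (Suc M)
    then obtain G where G: "D G = 0" "wt_ge n M (H1 - G)" by auto
    \<comment> \<open>Stated for an arbitrary \<open>G\<close>, because it is applied both to the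
      given approximation and to the corrected one.\<close>
    have rec: "(if j = 0 then 0 else (real M - real n * (real j - 1)) * lead n M (H1 - G) (j - 1))
        + q * (real j + 1) * lead n M (H1 - G) (j + 1) = 0"
      if "D G = 0" "wt_ge n M (H1 - G)" for G j
      using lead_recursion[OF n flatP flatQ' flatR' that(2), of "\<lambda>_. 0" j] that(1) Tlow Suc.prems
      by (simp add: Q'lead R'lead p0[unfolded p_def] D_def vf_diff del: One_nat_def)
    have up: "wt_ge n (Suc M) (H1 - G)"
      if G: "D G = 0" "wt_ge n M (H1 - G)" and 0: "lead n M (H1 - G) 0 = 0" for G
      using G(2)
    proof (rule wt_ge_Suc)
      show "lead n M (H1 - G) j = 0" for j
        using recursion_zero[of q "\<lambda>j. real M - real n * (real j - 1)" "lead n M (H1 - G)"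
            "\<lambda>_. 0" "\<lambda>_. 0" j] rec[OF G] q 0 by simp
    qed
    show ?case
    proof (cases "lead n M (H1 - G) 0 = 0")
      case True
      then show ?thesis using up G by blast
    next
      case False
      have "2 * n dvd M"
        by (rule recursion_center(1)[OF n q _ rec[OF G] False]) (simp add: lead_def)
      then obtain l where l: "M = 2 * n * l" by blast
      have El: "wt_ge n M (E ^ l)" "cf (E ^ l) M 0 \<noteq> 0"
        using wt_ge_power[OF E, of l] l by auto
      \<comment> \<open>Chosen to cancel the pure x-term of weight \<open>M\<close>; the homogeneous
        recursion then removes the whole part of that weight.\<close>
      define c where "c = lead n M (H1 - G) 0 / cf (E ^ l) M 0"
      define G' where "G' = G + in_x (fps_const c) * E ^ l"
      have eq: "H1 - G' = (H1 - G) - in_x (fps_const c) * E ^ l" by (simp add: G'_def)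
      have DG': "D G' = 0"
        using G(1) vf_power[of P Q' R' E l] DE by (simp add: D_def G'_def vf_add vf_scale)
      have "wt_ge n M (H1 - G')"
        unfolding eq by (intro wt_ge_diff wt_ge_scale G El)
      moreover have "lead n M (H1 - G') 0 = 0"
        unfolding eq lead_diff[of n M "H1 - G"] lead_scale using El by (simp add: c_def lead_def)
      ultimately show ?thesis using up DG' by blast
    qed
  qed

  \<comment> \<open>The inhomogeneous recursion at the critical weight\<close>
  define M where "M = N + m + 1 - n"
  have M: "M + n = N + m + 1" using mn by (simp add: M_def)
  obtain G where G: "D G = 0" "wt_ge n M (H1 - G)" using approx[of M] M by auto
  define r where "r = lead n M (H1 - G)"
  \<comment> \<open>D(\<open>H1 - G\<close>) = D \<open>H1\<close>, and its weight M + n - 1 = N + m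
    part is given by \<open>Tlead\<close>; beyond the range of monomials the forcing vanishes by
    \<open>hfin\<close>.\<close>
  have rrec: "(if j = 0 then 0 else (real M - real n * (real j - 1)) * r (j - 1))
      + q * (real j + 1) * r (j + 1) = - (fps_nth \<Phi> m * real j * h j)" for j
    using lead_recursion[OF n flatP flatQ' flatR' G(2), of "\<lambda>j. - (fps_nth \<Phi> m * real j * h j)" j]
      G(1) Tlead M hfin
    by (cases "j = 0") (simp_all add: Q'lead R'lead p0[unfolded p_def] D_def vf_diff r_def del: One_nat_def)
  have "2 * n dvd m + 1"
  proof (rule recursion_obstruction[OF n q \<Phi>m k0 _ _ rrec center(2) center(3)])
    show "M + n = m + 1 + 2 * n * k" using M k by simp
  qed (simp add: r_def lead_def)
  then obtain s where s: "m + 1 = 2 * n * s" by blast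
  then have "s \<ge> 1" by (cases s) auto
  moreover have "m = 2 * s * n - 1" using s by (simp add: mult.commute mult.left_commute)
  ultimately show ?thesis
    by (auto simp: m_def P_def)
qed simp

end
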